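(* Let $(X,d)$ be a complete $b$-metric space with coefficient $K\ge 1$. Let $T\colon X\to X$ be a mapping for which there exist real numbers $\alpha,\delta$ with $0\le\alpha<1$ and $\delta\ge 0$ such that $$d(Tx,Ty)\le \alpha\, d(x,y)+\delta\, d(y,Tx)\quad\text{for all } x,y\in X.$$ If $\alpha K<1$, then $T$ has a fixed point; and if moreover $\delta=0$, then the fixed point is unique.
   Context: A $b$-metric space with coefficient $K\ge 1$ is a nonempty set $X$ with a function $d\colon X\times X\to[0,\infty)$ such that for all $x,y,z\in X$: $d(x,y)=0$ if and only if $x=y$; $d(x,y)=d(y,x)$; and $d(x,y)\le K[d(x,z)+d(z,y)]$. A sequence $(x_n)$ in $X$ converges to $x\in X$ if $d(x_n,x)\to 0$; it is Cauchy if $d(x_n,x_m)\to 0$ as $n,m\to\infty$; $(X,d)$ is complete if every Cauchy sequence converges to some point of $X$. *)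

theory Defs
  imports Complex_Main "HOL-Library.FuncSet"
begin

text \<open>Spaces are given by a carrier set \<open>X\<close>; the distance \<open>d\<close> is constrained on \<open>X\<close> only.\<close>

locale b_metric_space =
  fixes X :: "'a set" and d :: "'a \<Rightarrow> 'a \<Rightarrow> real" and K :: real
  assumes nonempty: "X \<noteq> {}"
    and coefficient: "K \<ge> 1"
    and nonneg: "\<lbrakk>x \<in> X; y \<in> X\<rbrakk> \<Longrightarrow> d x y \<ge> 0"
    and zero_iff: "\<lbrakk>x \<in> X; y \<in> X\<rbrakk> \<Longrightarrow> d x y = 0 \<longleftrightarrow> x = y"
    and commute: "\<lbrakk>x \<in> X; y \<in> X\<rbrakk> \<Longrightarrow> d x y = d y x"
    and relaxed_triangle:
      "\<lbrakk>x \<in> X; y \<in> X; z \<in> X\<rbrakk> \<Longrightarrow> d x y \<le> K * (d x z + d z y)"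
begin

definition converges_to :: "(nat \<Rightarrow> 'a) \<Rightarrow> 'a \<Rightarrow> bool" where
  "converges_to s x \<longleftrightarrow> range s \<subseteq> X \<and> x \<in> X \<and> (\<lambda>n. d (s n) x) \<longlonglongrightarrow> 0"

definition cauchy :: "(nat \<Rightarrow> 'a) \<Rightarrow> bool" where
  "cauchy s \<longleftrightarrow> range s \<subseteq> X \<and>
     (\<forall>\<epsilon>>0. \<exists>N. \<forall>n\<ge>N. \<forall>m\<ge>N. d (s n) (s m) < \<epsilon>)"

end

locale complete_b_metric_space = b_metric_space +
  assumes complete: "cauchy s \<Longrightarrow> \<exists>x. converges_to s x"

end

theory Submission
  imports Defs
begin

text \<open>
  Put \<open>x = T\<^sup>n u\<close> and \<open>y = T x\<close> in the contractive condition.  The second term on the right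
  becomes \<open>\<delta> d(T x, T x) = 0\<close>, so consecutive distances along an orbit shrink by the factor \<open>\<alpha>\<close>,
  whatever the size of \<open>\<delta>\<close>.  In a metric space a sequence with geometrically decreasing steps is
  Cauchy by summing the steps; here every use of the relaxed triangle inequality costs a factor
  \<open>K\<close>, and the resulting series has ratio \<open>\<alpha> K\<close>.  This is where \<open>\<alpha> K < 1\<close> enters
  (lemma \<open>cauchy_if_geometric_steps\<close>).

  Let \<open>p\<close> be the limit of the orbit.  With \<open>x = T\<^sup>n u\<close> and \<open>y = p\<close>, both terms on the right of
  the condition are distances from orbit points to \<open>p\<close>, so the shifted orbit tends to \<open>T p\<close> as well
  as to \<open>p\<close>, and \<open>T p = p\<close> by uniqueness of limits.  Passing to the limit inside \<open>d\<close> would not be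
  legitimate, because a b-metric may be discontinuous in each variable.

  If \<open>\<delta> = 0\<close>, two fixed points satisfy \<open>d(x, y) \<le> \<alpha> d(x, y)\<close> with \<open>\<alpha> < 1\<close>, so they coincide.
\<close>

context b_metric_space
begin

lemma converges_to_unique:
  assumes "converges_to s x" and "converges_to s y"
  shows "x = y"
proof -
  from assms have s: "s n \<in> X" for n
    by (auto simp: converges_to_def)
  from assms have xy: "x \<in> X" "y \<in> X"
    and lim: "(\<lambda>n. d (s n) x) \<longlonglongrightarrow> 0" "(\<lambda>n. d (s n) y) \<longlonglongrightarrow> 0"
    by (auto simp: converges_to_def)
  have "(\<lambda>n. K * (d (s n) x + d (s n) y)) \<longlonglongrightarrow> K * (0 + 0)"
    by (intro tendsto_intros lim)
  moreover have "d x y \<le> K * (d (s n) x + d (s n) y)" for n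
    using relaxed_triangle[OF xy s[of n]] commute[OF xy(1) s[of n]] by simp
  ultimately have "d x y \<le> 0"
    using LIMSEQ_le_const[of _ "K * (0 + 0)"] by auto
  with nonneg[OF xy] zero_iff[OF xy] show ?thesis
    by simp
qed

text \<open>
  The constant is the sum of the geometric series \<open>K (a q\<^sup>n) (1 + q K + (q K)\<^sup>2 + \<dots>)\<close>, which arises
  by splitting off the first step of the remaining path again and again: step number \<open>n + i\<close> has
  length at most \<open>a q\<^sup>n q\<^sup>i\<close> and picks up \<open>i + 1\<close> factors \<open>K\<close>.  The bound is uniform in \<open>k\<close>.
\<close>

lemma geometric_steps_distance_bound:
  assumes s: "\<And>n. s n \<in> X"
    and step: "\<And>n. d (s n) (s (Suc n)) \<le> a * q ^ n"
    and q: "0 \<le> q" "q * K < 1"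
  shows "d (s n) (s (n + k)) \<le> K * a / (1 - q * K) * q ^ n"
proof (induction k arbitrary: n)
  case 0
  have "0 \<le> a"
    using nonneg[OF s s, of 0 1] step[of 0] by simp
  then show ?case
    using zero_iff[OF s s, of n n] coefficient q by simp
next
  case (Suc k)
  have "d (s n) (s (n + Suc k)) \<le> K * (d (s n) (s (Suc n)) + d (s (Suc n)) (s (Suc n + k)))"
    using relaxed_triangle[OF s s s, of n "n + Suc k" "Suc n"] by simp
  also have "\<dots> \<le> K * (a * q ^ n + K * a / (1 - q * K) * q ^ Suc n)"
    using coefficient by (intro mult_left_mono add_mono step Suc.IH) simp
  also have "\<dots> = K * a / (1 - q * K) * q ^ n"
    using q by (simp add: field_simps)
  finally show ?case .
qed

lemma cauchy_if_geometric_steps: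
  assumes s: "\<And>n. s n \<in> X"
    and step: "\<And>n. d (s n) (s (Suc n)) \<le> a * q ^ n"
    and q: "0 \<le> q" "q * K < 1"
  shows "cauchy s"
  unfolding cauchy_def
proof (intro conjI allI impI)
  show "range s \<subseteq> X"
    using s by auto
  fix \<epsilon> :: real
  assume "\<epsilon> > 0"
  let ?b = "\<lambda>n. K * a / (1 - q * K) * q ^ n"
  have "q * 1 \<le> q * K"
    using q(1) coefficient by (intro mult_left_mono)
  with q have "(\<lambda>n. q ^ n) \<longlonglongrightarrow> 0"
    by (intro LIMSEQ_power_zero) simp
  then have "?b \<longlonglongrightarrow> 0"
    by (rule tendsto_mult_right_zero)
  with \<open>\<epsilon> > 0\<close> obtain N where N: "\<And>n. n \<ge> N \<Longrightarrow> ?b n < \<epsilon>"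
    using order_tendstoD(2)[of ?b 0 sequentially \<epsilon>] unfolding eventually_sequentially by blast
  have ordered: "d (s n) (s m) < \<epsilon>" if "N \<le> n" "n \<le> m" for n m
    using geometric_steps_distance_bound[OF s step q, of n "m - n"] N[of n] that by simp
  have "d (s n) (s m) < \<epsilon>" if "N \<le> n" "N \<le> m" for n m
    using ordered[of n m] ordered[of m n] that commute[OF s s, of n m] by (cases "n \<le> m") auto
  then show "\<exists>N. \<forall>n\<ge>N. \<forall>m\<ge>N. d (s n) (s m) < \<epsilon>"
    by blast
qed

end

theorem corollary2p4:
  fixes X :: "'a set" and d :: "'a \<Rightarrow> 'a \<Rightarrow> real" and K :: real
    and T :: "'a \<Rightarrow> 'a" and \<alpha> \<delta> :: real
  assumes "complete_b_metric_space X d K"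
    and "T \<in> X \<rightarrow> X"
    and "0 \<le> \<alpha>" and "\<alpha> < 1" and "\<delta> \<ge> 0"
    and "\<And>x y. \<lbrakk>x \<in> X; y \<in> X\<rbrakk> \<Longrightarrow> d (T x) (T y) \<le> \<alpha> * d x y + \<delta> * d y (T x)"
    and "\<alpha> * K < 1"
  shows "(\<exists>x\<in>X. T x = x) \<and> (\<delta> = 0 \<longrightarrow> (\<exists>!x. x \<in> X \<and> T x = x))"
proof -
  interpret complete_b_metric_space X d K
    by fact
  note contr = assms(6)
  have T: "T x \<in> X" if "x \<in> X" for x
    using assms(2) that by auto
  obtain u where "u \<in> X"
    using nonempty by blast
  define s where "s n = (T ^^ n) u" for n
  have s_Suc: "s (Suc n) = T (s n)" for n
    by (simp add: s_def)
  have s: "s n \<in> X" for n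
    by (induction n) (simp_all add: s_def \<open>u \<in> X\<close> T)

  have "d (s n) (s (Suc n)) \<le> d (s 0) (s 1) * \<alpha> ^ n" for n
  proof (induction n)
    case 0
    show ?case by simp
  next
    case (Suc n)
    have "d (s (Suc n)) (s (Suc (Suc n))) \<le> \<alpha> * d (s n) (s (Suc n))"
      using contr[OF s s, of n "Suc n"] zero_iff[OF s s, of "Suc n" "Suc n"]
      by (simp add: s_Suc)
    also have "\<dots> \<le> \<alpha> * (d (s 0) (s 1) * \<alpha> ^ n)"
      using Suc.IH assms(3) by (rule mult_left_mono)
    finally show ?case
      by (simp add: ac_simps)
  qed
  from s this assms(3,7) have "cauchy s"
    by (rule cauchy_if_geometric_steps)
  then obtain p where "converges_to s p"
    using complete by blast
  then have p: "p \<in> X" and lim: "(\<lambda>n. d (s n) p) \<longlonglongrightarrow> 0"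
    by (auto simp: converges_to_def)
  have lim_Suc: "(\<lambda>n. d (s (Suc n)) p) \<longlonglongrightarrow> 0"
    using lim by (rule LIMSEQ_Suc)

  have "(\<lambda>n. d (s (Suc n)) (T p)) \<longlonglongrightarrow> 0"
  proof (rule tendsto_sandwich)
    show "\<forall>\<^sub>F n in sequentially. 0 \<le> d (s (Suc n)) (T p)"
      using nonneg[OF s T[OF p]] by simp
    show "\<forall>\<^sub>F n in sequentially. d (s (Suc n)) (T p) \<le> \<alpha> * d (s n) p + \<delta> * d (s (Suc n)) p"
      using contr[OF s p] commute[OF p T[OF s]] by (simp add: s_Suc)
    have "(\<lambda>n. \<alpha> * d (s n) p + \<delta> * d (s (Suc n)) p) \<longlonglongrightarrow> \<alpha> * 0 + \<delta> * 0"
      by (intro tendsto_intros lim lim_Suc)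
    then show "(\<lambda>n. \<alpha> * d (s n) p + \<delta> * d (s (Suc n)) p) \<longlonglongrightarrow> 0"
      by simp
  qed simp
  then have "converges_to (\<lambda>n. s (Suc n)) (T p)" "converges_to (\<lambda>n. s (Suc n)) p"
    using s p T lim_Suc by (auto simp: converges_to_def)
  then have fixed: "T p = p"
    by (rule converges_to_unique)

  have unique: "x = p" if "\<delta> = 0" "x \<in> X" "T x = x" for x
  proof -
    have "d x p \<le> \<alpha> * d x p"
      using contr[OF \<open>x \<in> X\<close> p] fixed that by simp
    then have "(1 - \<alpha>) * d x p \<le> 0"
      by (simp add: algebra_simps)
    then have "d x p \<le> 0"
      using assms(4) by (simp add: mult_le_0_iff)
    then show ?thesis
      using nonneg[OF \<open>x \<in> X\<close> p] zero_iff[OF \<open>x \<in> X\<close> p] by simp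
  qed
  from p fixed unique show ?thesis
    by blast
qed

end
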